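(* Let $h>0$, $\Delta t>0$, $\mu>0$, $\beta=\mu/h^2$, and let $\lambda$ be a real constant. Consider the linearized scheme for $(\delta_m^n)_{m\in\mathbb{Z},\,n\ge 0}$: $$\gamma_1\delta_{m-1}^{n+1}+\gamma_2\delta_m^{n+1}+\gamma_3\delta_{m+1}^{n+1}+\gamma_4\delta_{m+2}^{n+1}=\gamma_4\delta_{m-1}^{n}+\gamma_3\delta_m^{n}+\gamma_2\delta_{m+1}^{n}+\gamma_1\delta_{m+2}^{n},$$ where $$\gamma_1=\tfrac1{12}-\tfrac{\beta}{3}-\tfrac{\lambda\Delta t}{6},\quad \gamma_2=\tfrac{11}{12}+\tfrac{\beta}{3}-\tfrac{3\lambda\Delta t}{6},\quad \gamma_3=\tfrac{11}{12}+\tfrac{\beta}{3}+\tfrac{3\lambda\Delta t}{6},\quad \gamma_4=\tfrac1{12}-\tfrac{\beta}{3}+\tfrac{\lambda\Delta t}{6}.$$ For $k\in\mathbb{R}$ put $\theta=kh$ and $$a=(11+4\beta)\cos\tfrac{\theta}{2}+(1-4\beta)\cos\tfrac{3\theta}{2},\qquad b=2\lambda\Delta t\left[3\sin\tfrac{\theta}{2}+\sin\tfrac{3\theta}{2}\right].$$ If $a+ib\neq0$ and the Fourier mode $\delta_j^n=g^ne^{ijkh}$ (with $i=\sqrt{-1}$, $g\in\mathbb{C}\setminus\{0\}$) satisfies the scheme, then $$g=\frac{a-ib}{a+ib},$$ and hence $|g|=1$. That is, the linearized scheme is unconditionally stable (in the von Neumann sense, for every $h$ and $\Delta t$).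
   Context: The scheme is the Crank--Nicolson, Petrov--Galerkin discretization (quadratic B-spline trial functions, linear B-spline weight functions) of the generalized equal width equation $U_t+\varepsilon U^pU_x-\mu U_{xxt}=0$, in which $U^p$ in the nonlinear term is treated as locally constant, so that $\lambda=\varepsilon\hat U^p/h$ is a constant. Von Neumann stability means that the amplification factor $g$ of each Fourier mode satisfies $|g|\le1$. *)

theory Defs
  imports Complex_Main
begin

text \<open>Grid functions \<open>\<delta>\<close> are indexed as \<open>\<delta> n m\<close>: time level \<open>n\<close>, spatial index \<open>m\<close>.\<close>

definition gamma1 :: "real \<Rightarrow> real \<Rightarrow> real \<Rightarrow> real" where
  "gamma1 \<beta> lam dt = 1/12 - \<beta>/3 - lam * dt / 6"

definition gamma2 :: "real \<Rightarrow> real \<Rightarrow> real \<Rightarrow> real" where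
  "gamma2 \<beta> lam dt = 11/12 + \<beta>/3 - 3 * lam * dt / 6"

definition gamma3 :: "real \<Rightarrow> real \<Rightarrow> real \<Rightarrow> real" where
  "gamma3 \<beta> lam dt = 11/12 + \<beta>/3 + 3 * lam * dt / 6"

definition gamma4 :: "real \<Rightarrow> real \<Rightarrow> real \<Rightarrow> real" where
  "gamma4 \<beta> lam dt = 1/12 - \<beta>/3 + lam * dt / 6"

definition satisfies_scheme ::
  "real \<Rightarrow> real \<Rightarrow> real \<Rightarrow> (nat \<Rightarrow> int \<Rightarrow> complex) \<Rightarrow> bool" where
  "satisfies_scheme \<beta> lam dt \<delta> \<longleftrightarrow>
     (\<forall>n m.
        of_real (gamma1 \<beta> lam dt) * \<delta> (Suc n) (m - 1)
      + of_real (gamma2 \<beta> lam dt) * \<delta> (Suc n) m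
      + of_real (gamma3 \<beta> lam dt) * \<delta> (Suc n) (m + 1)
      + of_real (gamma4 \<beta> lam dt) * \<delta> (Suc n) (m + 2)
      = of_real (gamma4 \<beta> lam dt) * \<delta> n (m - 1)
      + of_real (gamma3 \<beta> lam dt) * \<delta> n m
      + of_real (gamma2 \<beta> lam dt) * \<delta> n (m + 1)
      + of_real (gamma1 \<beta> lam dt) * \<delta> n (m + 2))"

definition fourier_mode :: "real \<Rightarrow> real \<Rightarrow> complex \<Rightarrow> nat \<Rightarrow> int \<Rightarrow> complex" where
  "fourier_mode h k g n j = g ^ n * exp (\<i> * of_int j * of_real k * of_real h)"

definition coeff_a :: "real \<Rightarrow> real \<Rightarrow> real" where
  "coeff_a \<beta> \<theta> = (11 + 4*\<beta>) * cos (\<theta>/2) + (1 - 4*\<beta>) * cos (3*\<theta>/2)"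

definition coeff_b :: "real \<Rightarrow> real \<Rightarrow> real \<Rightarrow> real" where
  "coeff_b lam dt \<theta> = 2 * lam * dt * (3 * sin (\<theta>/2) + sin (3*\<theta>/2))"

text \<open>
  Von Neumann stability of a scheme \<open>S\<close> on a grid of width \<open>h\<close>: every amplification factor
  \<open>g\<close> of every Fourier mode has modulus at most 1.  Wave numbers for which the scheme holds
  identically in \<open>g\<close> have no amplification factor and must be left out: for the scheme above
  with \<open>lam = 0\<close> and \<open>k * h = pi\<close>, both sides vanish and every \<open>g\<close> is admitted.
\<close>
definition von_neumann_stable ::
  "real \<Rightarrow> ((nat \<Rightarrow> int \<Rightarrow> complex) \<Rightarrow> bool) \<Rightarrow> bool" where
  "von_neumann_stable h S \<longleftrightarrow>
     (\<forall>k. (\<exists>g. g \<noteq> 0 \<and> \<not> S (fourier_mode h k g)) \<longrightarrow>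
          (\<forall>g. g \<noteq> 0 \<and> S (fourier_mode h k g) \<longrightarrow> cmod g \<le> 1))"

end

theory Submission
  imports Defs
begin

text \<open>
  Both sides of the scheme carry the same four weights, in opposite order.  Viewed from the midpoint
  between the nodes \<open>m\<close> and \<open>m + 1\<close>, the four nodes lie at offsets \<open>-3/2\<close>, \<open>-1/2\<close>, \<open>1/2\<close>, \<open>3/2\<close>
  grid widths, so reversing the order of the weights amounts to replacing \<open>\<theta>\<close> by \<open>-\<theta>\<close>.  As the weights are
  real, this conjugates the symbol: up to the nonzero factor \<open>g ^ n * cis ((m + 1/2) * \<theta>) / 6\<close>
  common to both sides, a Fourier mode turns the left side into \<open>g * (a + \<i> * b)\<close> and the right
  side into \<open>a - \<i> * b\<close> (lemmas \<open>symbol_of_weights\<close> and \<open>scheme_fourier_mode_iff\<close>).  The scheme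
  thus reduces to \<open>g * (a + \<i> * b) = a - \<i> * b\<close>, which makes \<open>g\<close> a quotient of two conjugate numbers,
  of modulus 1.

  If \<open>a + \<i> * b = 0\<close>, its conjugate vanishes too and every \<open>g\<close> solves the equation.  Those are exactly
  the wave numbers that the definition of von Neumann stability sets aside.
\<close>

text \<open>
  Pairing opposite offsets leaves a cosine times the sum of two weights and a sine times their
  difference.  The first is free of \<open>lam\<close>, the second of \<open>\<beta>\<close>, which is why \<open>\<beta>\<close> enters only
  \<open>coeff_a\<close> and \<open>lam\<close> only \<open>coeff_b\<close>.
\<close>
lemma symbol_of_weights:
  "of_real (gamma1 \<beta> lam dt) * cis (- (3 * \<theta> / 2)) + of_real (gamma2 \<beta> lam dt) * cis (- (\<theta> / 2))
   + of_real (gamma3 \<beta> lam dt) * cis (\<theta> / 2) + of_real (gamma4 \<beta> lam dt) * cis (3 * \<theta> / 2)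
   = Complex (coeff_a \<beta> \<theta>) (coeff_b lam dt \<theta>) / 6"
  by (simp add: complex_eq_iff gamma1_def gamma2_def gamma3_def gamma4_def
      coeff_a_def coeff_b_def field_simps)

lemma reversed_symbol_of_weights:
  "of_real (gamma4 \<beta> lam dt) * cis (- (3 * \<theta> / 2)) + of_real (gamma3 \<beta> lam dt) * cis (- (\<theta> / 2))
   + of_real (gamma2 \<beta> lam dt) * cis (\<theta> / 2) + of_real (gamma1 \<beta> lam dt) * cis (3 * \<theta> / 2)
   = cnj (Complex (coeff_a \<beta> \<theta>) (coeff_b lam dt \<theta>)) / 6"
  using arg_cong[OF symbol_of_weights[of \<beta> lam dt \<theta>], of cnj]
  by (simp add: cis_cnj algebra_simps del: cnj.simps)

lemma fourier_mode_about_midpoint: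
  fixes m j :: int
  shows "fourier_mode h k g n (m + j)
    = g ^ n * cis ((of_int m + 1/2) * (k * h)) * cis ((of_int j - 1/2) * (k * h))"
proof -
  have "exp (\<i> * of_int (m + j) * of_real k * of_real h) = cis (of_int (m + j) * (k * h))"
    by (simp add: cis_conv_exp algebra_simps)
  also have "\<dots> = cis ((of_int m + 1/2) * (k * h)) * cis ((of_int j - 1/2) * (k * h))"
    unfolding cis_mult by (rule arg_cong[where f = cis]) (simp add: field_simps)
  finally show ?thesis
    by (simp add: fourier_mode_def mult.assoc)
qed

lemma scheme_fourier_mode_iff:
  assumes "g \<noteq> 0"
  defines "z \<equiv> \<lambda>\<beta> lam dt \<theta>. Complex (coeff_a \<beta> \<theta>) (coeff_b lam dt \<theta>)"
  shows "satisfies_scheme \<beta> lam dt (fourier_mode h k g)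
    \<longleftrightarrow> g * z \<beta> lam dt (k * h) = cnj (z \<beta> lam dt (k * h))"
proof -
  define \<theta> where "\<theta> = k * h"
  define F where "F = (\<lambda>n (m::int). g ^ n * cis ((of_int m + 1/2) * \<theta>))"
  have F: "F n m \<noteq> 0" "F (Suc n) m = F n m * g" for n m
    using assms(1) by (simp_all add: F_def)
  have mode: "fourier_mode h k g n (m - 1) = F n m * cis (- (3 * \<theta> / 2))"
    "fourier_mode h k g n m = F n m * cis (- (\<theta> / 2))"
    "fourier_mode h k g n (m + 1) = F n m * cis (\<theta> / 2)"
    "fourier_mode h k g n (m + 2) = F n m * cis (3 * \<theta> / 2)" for n m
    using fourier_mode_about_midpoint[of h k g n m "-1"] fourier_mode_about_midpoint[of h k g n m 0]
      fourier_mode_about_midpoint[of h k g n m 1] fourier_mode_about_midpoint[of h k g n m 2]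
    by (simp_all add: F_def \<theta>_def)
  have factor: "p * (c * x) + q * (c * y) + r * (c * u) + s * (c * v)
      = c * (p * x + q * y + r * u + s * v)" for c p q r s x y u v :: complex
    by (simp add: algebra_simps)
  have "satisfies_scheme \<beta> lam dt (fourier_mode h k g)
    \<longleftrightarrow> (\<forall>n m. F (Suc n) m * (z \<beta> lam dt \<theta> / 6) = F n m * (cnj (z \<beta> lam dt \<theta>) / 6))"
    (* The unshifted node comes last, since its equation matches the shifted nodes as well. *)
    unfolding satisfies_scheme_def mode(1,3,4)
    unfolding mode(2) factor symbol_of_weights reversed_symbol_of_weights z_def ..
  also have "\<dots> \<longleftrightarrow> g * z \<beta> lam dt \<theta> = cnj (z \<beta> lam dt \<theta>)"
    by (simp add: F mult.assoc)
  finally show ?thesis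
    by (simp add: \<theta>_def)
qed

lemma conjugate_ratio:
  fixes g z :: complex
  assumes "g * z = cnj z" and "z \<noteq> 0"
  shows "g = cnj z / z" and "cmod g = 1"
proof -
  show "g = cnj z / z"
    using assms by (simp add: field_simps)
  then show "cmod g = 1"
    using assms(2) by (simp add: norm_divide)
qed

theorem mainTheorem3:
  fixes h dt \<mu> \<beta> lam :: real
  assumes "h > 0" and "dt > 0" and "\<mu> > 0" and "\<beta> = \<mu> / h\<^sup>2"
  shows "(\<forall>(k::real) (g::complex) (\<theta>::real) (a::real) (b::real).
            \<theta> = k * h \<and> a = coeff_a \<beta> \<theta> \<and> b = coeff_b lam dt \<theta> \<and>
            of_real a + \<i> * of_real b \<noteq> 0 \<and> g \<noteq> 0 \<and>
            satisfies_scheme \<beta> lam dt (fourier_mode h k g) \<longrightarrow>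
            g = (of_real a - \<i> * of_real b) / (of_real a + \<i> * of_real b) \<and> cmod g = 1)
       \<and> von_neumann_stable h (satisfies_scheme \<beta> lam dt)"
proof
  show "\<forall>(k::real) (g::complex) (\<theta>::real) (a::real) (b::real).
            \<theta> = k * h \<and> a = coeff_a \<beta> \<theta> \<and> b = coeff_b lam dt \<theta> \<and>
            of_real a + \<i> * of_real b \<noteq> 0 \<and> g \<noteq> 0 \<and>
            satisfies_scheme \<beta> lam dt (fourier_mode h k g) \<longrightarrow>
            g = (of_real a - \<i> * of_real b) / (of_real a + \<i> * of_real b) \<and> cmod g = 1"
  proof (intro allI impI, elim conjE)
    fix k g \<theta> a b
    assume eqs: "\<theta> = k * h" "a = coeff_a \<beta> \<theta>" "b = coeff_b lam dt \<theta>"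
      and nz: "of_real a + \<i> * of_real b \<noteq> 0" and "g \<noteq> 0"
      and "satisfies_scheme \<beta> lam dt (fourier_mode h k g)"
    then have "g * Complex a b = cnj (Complex a b)"
      by (simp add: scheme_fourier_mode_iff)
    moreover have "Complex a b \<noteq> 0"
      using nz by (simp add: Complex_eq)
    ultimately have "g = cnj (Complex a b) / Complex a b" and "cmod g = 1"
      by (rule conjugate_ratio)+
    then show "g = (of_real a - \<i> * of_real b) / (of_real a + \<i> * of_real b) \<and> cmod g = 1"
      by (simp add: Complex_eq)
  qed
  show "von_neumann_stable h (satisfies_scheme \<beta> lam dt)"
    unfolding von_neumann_stable_def
  proof (intro allI impI, elim exE conjE)
    fix k g g'
    define z where "z = Complex (coeff_a \<beta> (k * h)) (coeff_b lam dt (k * h))"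
    assume "g' \<noteq> 0" and "\<not> satisfies_scheme \<beta> lam dt (fourier_mode h k g')"
    then have "z \<noteq> 0"
      by (auto simp: scheme_fourier_mode_iff z_def[symmetric])
    moreover assume "g \<noteq> 0" and "satisfies_scheme \<beta> lam dt (fourier_mode h k g)"
    then have "g * z = cnj z"
      by (simp add: scheme_fourier_mode_iff z_def)
    ultimately show "cmod g \<le> 1"
      using conjugate_ratio(2) by fastforce
  qed
qed

end
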